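(* Let $p\ge q\ge2$. The dominant, indivisible, $\mathfrak{p}^-$-admissible one-parameter subgroups of $T_{\mathbb{C}}$ for $G=SU(p,q)$ are the one-parameter subgroups $$\lambda_{k,l}=(\underbrace{a,\dots,a}_{k},\underbrace{b,\dots,b}_{p-k};\underbrace{a,\dots,a}_{l},\underbrace{b,\dots,b}_{q-l}),\qquad k=1,\dots,p-1,\ l=1,\dots,q-1,$$ with $a=\frac{p+q-k-l}{\gcd(p+q-k-l,k+l)}$ and $b=\frac{-(k+l)}{\gcd(p+q-k-l,k+l)}$, together with the four one-parameter subgroups $$\begin{aligned}\lambda_{p,q-1}&=(1,\dots,1;1,\dots,1,1-p-q),\\ \lambda_{p-1,q}&=(1,\dots,1,1-p-q;1,\dots,1),\\ \lambda_{0,1}&=(-1,\dots,-1;p+q-1,-1,\dots,-1),\\ \lambda_{1,0}&=(p+q-1,-1,\dots,-1;-1,\dots,-1).\end{aligned}$$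
   Context: For $G=SU(p,q)$ the maximal compact subgroup is $K=S(U(p)\times U(q))$, with complexification $K_{\mathbb{C}}=S(GL_p(\mathbb{C})\times GL_q(\mathbb{C}))$; $T_{\mathbb{C}}$ is its torus of diagonal matrices. A one-parameter subgroup of $T_{\mathbb{C}}$ is $\lambda=(\lambda_1,\dots,\lambda_p;\lambda_{p+1},\dots,\lambda_{p+q})\in\mathbb{Z}^{p+q}$ with $\sum\lambda_i=0$ (i.e. $t\mapsto\mathrm{diag}(t^{\lambda_i})$). It is dominant if $\lambda_1\ge\dots\ge\lambda_p$ and $\lambda_{p+1}\ge\dots\ge\lambda_{p+q}$, and indivisible if it is not $n\lambda'$ with $n>1$ an integer and $\lambda'$ a one-parameter subgroup of $T_{\mathbb{C}}$. $\mathfrak{p}^-$ is the $K_{\mathbb{C}}$-module of matrices $\begin{pmatrix}0&0\\C&0\end{pmatrix}\in\mathfrak{sl}_{p+q}(\mathbb{C})$ with $C$ of size $q\times p$, under conjugation; its $T_{\mathbb{C}}$-weights are $-(e_i^*-e_{p+j}^* )$, $1\le i\le p$, $1\le j\le q$. $\lambda$ is $\mathfrak{p}^-$-admissible if there is $v\in\mathfrak{p}^-$ such that $\lambda(\mathbb{C}^* )$ is the identity component of the stabilizer of $v$ in $T_{\mathbb{C}}$; equivalently, the line $\mathbb{C}\lambda\subset\mathfrak{t}_{\mathbb{C}}$ is the intersection of the kernels of a family of weights of $\mathfrak{p}^-$. *)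

theory Defs
  imports
    "HOL-Analysis.Analysis"
    "Jordan_Normal_Form.Determinant"
    "Jordan_Normal_Form.Gauss_Jordan_Elimination"
begin

definition K_cplx :: "nat \<Rightarrow> nat \<Rightarrow> complex mat set" where
  "K_cplx p q = {four_block_mat A (0\<^sub>m p q) (0\<^sub>m q p) D | A D.
     A \<in> carrier_mat p p \<and> invertible_mat A \<and> D \<in> carrier_mat q q \<and> invertible_mat D \<and>
     Determinant.det (four_block_mat A (0\<^sub>m p q) (0\<^sub>m q p) D) = 1}"

definition T_cplx :: "nat \<Rightarrow> nat \<Rightarrow> complex mat set" where
  "T_cplx p q = {g \<in> K_cplx p q. diagonal_mat g}"

definition p_minus :: "nat \<Rightarrow> nat \<Rightarrow> complex mat set" where
  "p_minus p q = {four_block_mat (0\<^sub>m p p) (0\<^sub>m p q) C (0\<^sub>m q q) | C. C \<in> carrier_mat q p}"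

definition conj_act :: "complex mat \<Rightarrow> complex mat \<Rightarrow> complex mat" where
  "conj_act g v = g * v * the (mat_inverse g)"

definition T_stabilizer :: "nat \<Rightarrow> nat \<Rightarrow> complex mat \<Rightarrow> complex mat set" where
  "T_stabilizer p q v = {g \<in> T_cplx p q. conj_act g v = v}"

text \<open>The library type of matrices carries no topology. The Euclidean topology on
  \<open>n \<times> n\<close> complex matrices is pulled back here along the family of all entries. The restriction to
  \<open>{..<n} \<times> {..<n}\<close> is needed because the library does not fix the values of a matrix outside
  its dimensions.\<close>

definition mat_topology :: "nat \<Rightarrow> complex mat topology" where
  "mat_topology n = pullback_topology (carrier_mat n n)
     (\<lambda>A. \<lambda>ij\<in>{..<n} \<times> {..<n}. A $$ ij)
     (product_topology (\<lambda>_. euclidean) ({..<n} \<times> {..<n}))"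

text \<open>For a Zariski-closed group of matrices over the complex numbers, the identity component in the
  Euclidean topology is the same as the one in the Zariski topology.\<close>

definition identity_component :: "nat \<Rightarrow> complex mat set \<Rightarrow> complex mat set" where
  "identity_component n H = connected_component_of_set (subtopology (mat_topology n) H) (1\<^sub>m n)"

text \<open>A tuple \<open>(\<lambda>\<^sub>1, \<dots>, \<lambda>\<^sub>p; \<lambda>\<^sub>p\<^sub>+\<^sub>1, \<dots>, \<lambda>\<^sub>p\<^sub>+\<^sub>q)\<close> is the list of its entries, so that \<open>\<lambda>\<^sub>i\<close> is entry
  \<open>i - 1\<close> of the list.\<close>

definition one_param_subgroups :: "nat \<Rightarrow> nat \<Rightarrow> int list set" where
  "one_param_subgroups p q = {lam. length lam = p + q \<and> sum_list lam = 0}"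

definition ops_eval :: "int list \<Rightarrow> complex \<Rightarrow> complex mat" where
  "ops_eval lam t = mat_diag (length lam) (\<lambda>i. t powi (lam ! i))"

definition dominant :: "nat \<Rightarrow> int list \<Rightarrow> bool" where
  "dominant p lam \<longleftrightarrow> sorted_wrt (\<ge>) (take p lam) \<and> sorted_wrt (\<ge>) (drop p lam)"

definition indivisible :: "nat \<Rightarrow> nat \<Rightarrow> int list \<Rightarrow> bool" where
  "indivisible p q lam \<longleftrightarrow>
     \<not> (\<exists>n>1. \<exists>mu\<in>one_param_subgroups p q. lam = map (\<lambda>x. n * x) mu)"

definition p_minus_admissible :: "nat \<Rightarrow> nat \<Rightarrow> int list \<Rightarrow> bool" where
  "p_minus_admissible p q lam \<longleftrightarrow>
     (\<exists>v\<in>p_minus p q. ops_eval lam ` (- {0}) = identity_component (p + q) (T_stabilizer p q v))"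

definition lam_kl :: "nat \<Rightarrow> nat \<Rightarrow> nat \<Rightarrow> nat \<Rightarrow> int list" where
  "lam_kl p q k l =
     (let m = int p + int q - int k - int l;
          n = int k + int l;
          a = m div gcd m n;
          b = (- n) div gcd m n
      in replicate k a @ replicate (p - k) b @ replicate l a @ replicate (q - l) b)"

end

theory Submission
  imports Defs
begin

text \<open>A diagonal matrix stabilizes \<open>v\<close> iff its entries are constant along the edges of the bipartite
  graph on \<open>{0..<p} \<union> {p..<p+q}\<close> given by the support of \<open>v\<close>. A one-parameter subgroup \<open>\<mu>\<close> that is
  constant along the edges has connected image through \<open>1\<close>, so it lies in the identity component; if
  the latter is \<open>\<lambda>(\<complex>\<^sup>*)\<close>, comparing absolute values at \<open>2\<close> shows that \<open>\<mu>\<close> is a real multiple of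
  \<open>\<lambda>\<close>. Testing this with indicator functions shows that \<open>\<lambda>\<close> has exactly two values and that no level
  set with two or more elements lies on one side of the bipartition. Conversely, for such a \<open>\<lambda>\<close> with
  coprime values \<open>a, -b\<close>, join all pairs of indices with equal values: the stabilizer is the set of
  pairs \<open>(x, y)\<close> with \<open>(x\<^sup>b y\<^sup>a)\<^sup>g = 1\<close> for some \<open>g > 0\<close>. On the identity component the continuous function
  \<open>x\<^sup>b y\<^sup>a\<close> has finitely many values, so it is \<open>1\<close>, and Bezout gives \<open>(x, y) = (s\<^sup>a, s\<^sup>-\<^sup>b)\<close>.\<close>

section \<open>Inverses and determinants of diagonal matrices\<close>

lemma mat_diag_inverse:
  fixes d :: "nat \<Rightarrow> 'a::field"
  assumes "\<forall>i<n. d i \<noteq> 0"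
  shows "mat_diag n d * mat_diag n (\<lambda>i. inverse (d i)) = 1\<^sub>m n"
    and "mat_diag n (\<lambda>i. inverse (d i)) * mat_diag n d = 1\<^sub>m n"
  using assms by (auto simp: mat_diag_def[of n "\<lambda>i. d i * inverse (d i)"]
      mat_diag_def[of n "\<lambda>i. inverse (d i) * d i"])

lemma invertible_mat_diag:
  fixes d :: "nat \<Rightarrow> 'a::field"
  assumes "\<forall>i<n. d i \<noteq> 0"
  shows "invertible_mat (mat_diag n d)"
  unfolding invertible_mat_def inverts_mat_def
  using mat_diag_inverse[OF assms] by (auto simp: mat_diag_def square_mat.simps)

text \<open>Only the two characteristic facts of \<open>mat_inverse\<close> are used:
  \<open>None\<close> contradicts that the matrix is a unit of the matrix ring, and any
  \<open>Some B\<close> is the expected matrix because inverses are unique.\<close>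

lemma mat_inverse_mat_diag:
  fixes d :: "nat \<Rightarrow> 'a::field"
  assumes "\<forall>i<n. d i \<noteq> 0"
  shows "mat_inverse (mat_diag n d) = Some (mat_diag n (\<lambda>i. inverse (d i)))"
proof (cases "mat_inverse (mat_diag n d)")
  case None
  have "mat_diag n d \<in> Units (ring_mat TYPE('a) n ())"
    using mat_diag_inverse[OF assms] unfolding Units_def
    by (auto simp: ring_mat_simps intro!: bexI[of _ "mat_diag n (\<lambda>i. inverse (d i))"])
  with mat_inverse(1)[OF mat_diag_dim None, where b = "()"] show ?thesis by blast
next
  case (Some B)
  let ?E = "mat_diag n (\<lambda>i. inverse (d i))"
  have B: "mat_diag n d * B = 1\<^sub>m n" "B \<in> carrier_mat n n"
    using mat_inverse(2)[OF mat_diag_dim Some] by auto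
  have "B = (?E * mat_diag n d) * B" using B(2) mat_diag_inverse(2)[OF assms] by simp
  also have "\<dots> = ?E * (mat_diag n d * B)"
    by (rule assoc_mult_mat[OF mat_diag_dim mat_diag_dim B(2)])
  also have "\<dots> = ?E" using B(1) by (metis mat_diag_dim right_mult_one_mat)
  finally show ?thesis using Some by simp
qed

lemma det_mat_diag: "Determinant.det (mat_diag n d) = (\<Prod>i<n. d i)"
proof -
  have "Determinant.det (mat_diag n d) = prod_list (diag_mat (mat_diag n d))"
    by (rule det_upper_triangular[of _ n]) (auto simp: mat_diag_def)
  also have "\<dots> = (\<Prod>i<n. d i)"
    by (auto simp: diag_mat_def mat_diag_def prod.list_conv_set_nth
        atLeast0LessThan intro!: prod.cong)
  finally show ?thesis .
qed

lemma mat_diag_cong: "(\<And>i. i < n \<Longrightarrow> d i = e i) \<Longrightarrow> mat_diag n d = mat_diag n e"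
  unfolding mat_diag_def by (intro eq_matI) auto

lemma mat_diag_nth: "i < n \<Longrightarrow> mat_diag n d $$ (i,i) = d i"
  by (simp add: mat_diag_def)

section \<open>The diagonal torus and its stabilizers\<close>

lemma T_cplx_eq: "T_cplx p q = {mat_diag (p + q) d | d. (\<Prod>i<p+q. d i) = 1}"
proof (intro equalityI subsetI)
  fix g assume "g \<in> T_cplx p q"
  then have g: "g \<in> carrier_mat (p + q) (p + q)" "diagonal_mat g" "Determinant.det g = 1"
    unfolding T_cplx_def K_cplx_def by auto
  define d where "d i = g $$ (i,i)" for i
  have "g = mat_diag (p + q) d"
    using g unfolding d_def mat_diag_def diagonal_mat_def by (intro eq_matI) auto
  with g(3) show "g \<in> {mat_diag (p + q) d | d. (\<Prod>i<p+q. d i) = 1}"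
    by (auto simp: det_mat_diag)
next
  fix g assume "g \<in> {mat_diag (p + q) d | d. (\<Prod>i<p+q. d i) = (1::complex)}"
  then obtain d where d: "g = mat_diag (p + q) d" "(\<Prod>i<p+q. d i) = 1" by blast
  have nz: "\<forall>i<p+q. d i \<noteq> 0" using d(2) by (metis finite_lessThan lessThan_iff prod_zero zero_neq_one)
  let ?A = "mat_diag p d" and ?D = "mat_diag q (\<lambda>j. d (p + j))"
  have eq: "g = four_block_mat ?A (0\<^sub>m p q) (0\<^sub>m q p) ?D"
    unfolding d(1) mat_diag_def by (intro eq_matI) auto
  have "Determinant.det (four_block_mat ?A (0\<^sub>m p q) (0\<^sub>m q p) ?D) = 1"
    unfolding eq[symmetric] d(1) by (simp add: det_mat_diag d(2))
  moreover have "invertible_mat ?A" "invertible_mat ?D"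
    using nz by (auto intro!: invertible_mat_diag)
  ultimately have "g \<in> K_cplx p q"
    unfolding K_cplx_def eq using mat_diag_dim by blast
  moreover have "diagonal_mat g" by (simp add: d(1) mat_diag_def diagonal_mat_def)
  ultimately show "g \<in> T_cplx p q" by (simp add: T_cplx_def)
qed

text \<open>Conjugation multiplies the entry at \<open>(r,s)\<close> by \<open>d r / d s\<close>, so
  only the support of \<open>v\<close> matters. This is where the graph on the indices comes
  from.\<close>

lemma conj_act_mat_diag:
  assumes "v \<in> carrier_mat n n" "\<forall>i<n. d i \<noteq> 0"
  shows "conj_act (mat_diag n d) v = v \<longleftrightarrow>
    (\<forall>r<n. \<forall>s<n. v $$ (r,s) \<noteq> 0 \<longrightarrow> d r = d s)"
proof -
  have "conj_act (mat_diag n d) v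
      = Matrix.mat n n (\<lambda>(i,j). d i * v $$ (i,j) * inverse (d j))"
    using assms unfolding conj_act_def mat_inverse_mat_diag[OF assms(2)]
    by (auto simp: mat_diag_mult_left[of v n n] mat_diag_mult_right[where nr = n])
  also have "\<dots> = v \<longleftrightarrow> (\<forall>r<n. \<forall>s<n. d r * v $$ (r,s) * inverse (d s) = v $$ (r,s))"
    using assms(1) by (auto simp: mat_eq_iff)
  also have "\<dots> \<longleftrightarrow> (\<forall>r<n. \<forall>s<n. v $$ (r,s) \<noteq> 0 \<longrightarrow> d r = d s)"
    using assms(2) by (auto simp: field_simps)
  finally show ?thesis .
qed

lemma p_minus_carrier: "v \<in> p_minus p q \<Longrightarrow> v \<in> carrier_mat (p + q) (p + q)"
  unfolding p_minus_def by auto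

lemma p_minus_support:
  assumes "v \<in> p_minus p q" "r < p + q" "s < p + q" "v $$ (r,s) \<noteq> 0"
  shows "p \<le> r" "s < p"
  using assms unfolding p_minus_def by (auto split: if_splits)

lemma T_stabilizer_eq:
  assumes "v \<in> p_minus p q"
  shows "T_stabilizer p q v = {mat_diag (p + q) d | d. (\<Prod>i<p+q. d i) = 1 \<and>
    (\<forall>r<p+q. \<forall>s<p+q. v $$ (r,s) \<noteq> 0 \<longrightarrow> d r = d s)}"
proof -
  have nz: "\<forall>i<p+q. d i \<noteq> 0" if "(\<Prod>i<p+q. d i) = 1" for d :: "nat \<Rightarrow> complex"
    using that by (metis finite_lessThan lessThan_iff prod_zero zero_neq_one)
  show ?thesis
    unfolding T_stabilizer_def T_cplx_eq
    using conj_act_mat_diag[OF p_minus_carrier[OF assms] nz] by blast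
qed

text \<open>The determinant condition is automatic: the product of the diagonal entries is
  \<open>t\<close> raised to the sum of \<open>mu\<close>, which is 0.\<close>

lemma ops_eval_in_T_stabilizer_iff:
  assumes "v \<in> p_minus p q" "mu \<in> one_param_subgroups p q" "t \<noteq> 0"
  shows "ops_eval mu t \<in> T_stabilizer p q v \<longleftrightarrow>
    (\<forall>r<p+q. \<forall>s<p+q. v $$ (r,s) \<noteq> 0 \<longrightarrow> t powi (mu ! r) = t powi (mu ! s))" (is "_ \<longleftrightarrow> ?R")
proof
  have len: "length mu = p + q" and sum: "(\<Sum>i<p+q. mu ! i) = 0"
    using assms(2) by (auto simp: one_param_subgroups_def sum_list_sum_nth atLeast0LessThan)
  {
    assume "ops_eval mu t \<in> T_stabilizer p q v"
    then obtain d where d: "mat_diag (p + q) (\<lambda>i. t powi (mu ! i)) = mat_diag (p + q) d"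
      "\<forall>r<p+q. \<forall>s<p+q. v $$ (r,s) \<noteq> 0 \<longrightarrow> d r = d s"
      unfolding T_stabilizer_eq[OF assms(1)] ops_eval_def len by blast
    have "t powi (mu ! i) = d i" if "i < p + q" for i
      using arg_cong[OF d(1), of "\<lambda>M. M $$ (i,i)"] that by (simp add: mat_diag_nth)
    with d(2) show ?R by simp
  }
  have "(\<Prod>i\<in>I. t powi (mu ! i)) = t powi (\<Sum>i\<in>I. mu ! i)" if "finite I" for I
    using that by (induction I) (auto simp: power_int_add assms(3))
  then have "(\<Prod>i<p+q. t powi (mu ! i)) = 1" by (simp add: sum)
  then show "ops_eval mu t \<in> T_stabilizer p q v" if ?R
    using that unfolding T_stabilizer_eq[OF assms(1)] ops_eval_def len by blast
qed

section \<open>Topology of matrices and the identity component\<close>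

lemma topspace_mat_topology [simp]: "topspace (mat_topology n) = carrier_mat n n"
  by (auto simp: mat_topology_def topspace_pullback_topology)

lemma continuous_map_mat_entry:
  assumes "i < n" "j < n"
  shows "continuous_map (mat_topology n) euclidean (\<lambda>A. A $$ (i,j))"
proof -
  have "continuous_map (mat_topology n) euclidean
      ((\<lambda>x. x (i,j)) \<circ> (\<lambda>A. \<lambda>ij\<in>{..<n} \<times> {..<n}. A $$ ij))"
    unfolding mat_topology_def using assms
    by (intro continuous_map_pullback continuous_map_product_projection) auto
  then show ?thesis using assms by (simp add: o_def)
qed

lemma continuous_map_into_mat_topology:
  assumes "\<And>x. x \<in> topspace X \<Longrightarrow> f x \<in> carrier_mat n n"
    and "\<And>i j. i < n \<Longrightarrow> j < n \<Longrightarrow> continuous_map X euclidean (\<lambda>x. f x $$ (i,j))"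
  shows "continuous_map X (mat_topology n) f"
  unfolding mat_topology_def
proof (rule continuous_map_pullback')
  show "continuous_map X (product_topology (\<lambda>_. euclidean) ({..<n} \<times> {..<n}))
     ((\<lambda>A. \<lambda>ij\<in>{..<n} \<times> {..<n}. A $$ ij) \<circ> f)"
    using assms(2) by (auto simp: continuous_map_componentwise o_def)
qed (use assms(1) in auto)

lemma ops_eval_1: "length mu = n \<Longrightarrow> ops_eval mu 1 = 1\<^sub>m n"
  by (simp add: ops_eval_def)

text \<open>The punctured plane is connected and 1 is sent to the identity matrix, so the image is a
  connected subset of the stabilizer through the identity.\<close>

lemma ops_image_subset_identity_component:
  assumes v: "v \<in> p_minus p q" and mu: "mu \<in> one_param_subgroups p q"
    and edges: "\<forall>r<p+q. \<forall>s<p+q. v $$ (r,s) \<noteq> 0 \<longrightarrow> mu ! r = mu ! s"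
  shows "ops_eval mu ` (- {0}) \<subseteq> identity_component (p + q) (T_stabilizer p q v)"
proof -
  have len: "length mu = p + q" using mu by (simp add: one_param_subgroups_def)
  have "continuous_map (top_of_set (- {0})) (mat_topology (p + q)) (ops_eval mu)"
  proof (rule continuous_map_into_mat_topology)
    fix i j assume "i < p + q" "j < p + q"
    then have "(\<lambda>t. ops_eval mu t $$ (i,j)) = (\<lambda>t. if i = j then t powi (mu ! j) else 0)"
      by (auto simp: ops_eval_def mat_diag_def len)
    then show "continuous_map (top_of_set (- {0})) euclidean (\<lambda>t. ops_eval mu t $$ (i,j))"
      by (auto intro!: continuous_intros)
  qed (auto simp: ops_eval_def len)
  then have "connectedin (mat_topology (p + q)) (ops_eval mu ` (- {0}))"
    by (rule connectedin_continuous_map_image)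
      (use connected_punctured_universe[of "0::complex"] in
        \<open>simp add: connectedin_subtopology\<close>)
  moreover have "ops_eval mu ` (- {0}) \<subseteq> T_stabilizer p q v"
    using edges ops_eval_in_T_stabilizer_iff[OF v mu] by auto
  ultimately have "connectedin (subtopology (mat_topology (p + q)) (T_stabilizer p q v))
      (ops_eval mu ` (- {0}))" by (simp add: connectedin_subtopology)
  moreover have "1\<^sub>m (p + q) \<in> ops_eval mu ` (- {0})"
    using ops_eval_1[OF len] by (metis Compl_iff imageI singletonD zero_neq_one)
  ultimately show ?thesis
    unfolding identity_component_def by (rule connected_component_of_maximal)
qed

lemma identity_component_subset: "identity_component n H \<subseteq> H"
  unfolding identity_component_def
  using connected_component_of_subset_topspace[of "subtopology (mat_topology n) H" "1\<^sub>m n"] by auto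

section \<open>Necessary conditions for admissibility\<close>

lemma admissible_imp_edge:
  assumes "v \<in> p_minus p q" "lam \<in> one_param_subgroups p q"
    and "ops_eval lam ` (- {0}) = identity_component (p + q) (T_stabilizer p q v)"
    and "r < p + q" "s < p + q" "v $$ (r,s) \<noteq> 0"
  shows "lam ! r = lam ! s"
proof -
  \<comment> \<open>The single sample point 2 suffices: its absolute value is not 1, so its integer
    powers determine their exponents.\<close>
  have "ops_eval lam 2 \<in> T_stabilizer p q v"
    using assms(3) identity_component_subset[of "p + q" "T_stabilizer p q v"] by auto
  then have "(2::complex) powi (lam ! r) = 2 powi (lam ! s)"
    using assms by (simp add: ops_eval_in_T_stabilizer_iff)
  then have "norm ((2::complex) powi (lam ! r)) = norm ((2::complex) powi (lam ! s))" by simp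
  then have "(2::real) powi (lam ! r) = 2 powi (lam ! s)" by (simp add: norm_power_int)
  then have "(2::real) powr (lam ! r) = 2 powr (lam ! s)" by (simp add: powr_real_of_int')
  then show ?thesis by (metis of_int_eq_iff powr_inj zero_less_numeral numeral_eq_one_iff semiring_norm(85))
qed

text \<open>The matrix of \<open>mu\<close> at 2 equals that of \<open>lam\<close> at some
  \<open>t\<close>. Logarithms of absolute values of the diagonal entries give the factor
  \<open>ln (norm t) / ln 2\<close>, the same for every index.\<close>

lemma admissible_imp_proportional:
  assumes "v \<in> p_minus p q" "lam \<in> one_param_subgroups p q"
    and eq: "ops_eval lam ` (- {0}) = identity_component (p + q) (T_stabilizer p q v)"
    and mu: "mu \<in> one_param_subgroups p q"
      "\<forall>r<p+q. \<forall>s<p+q. v $$ (r,s) \<noteq> 0 \<longrightarrow> mu ! r = mu ! s"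
  obtains c :: real where "\<And>i. i < p + q \<Longrightarrow> real_of_int (mu ! i) = c * lam ! i"
proof -
  have len: "length mu = p + q" "length lam = p + q"
    using assms(2) mu(1) by (auto simp: one_param_subgroups_def)
  have "ops_eval mu 2 \<in> ops_eval lam ` (- {0})"
    using ops_image_subset_identity_component[OF assms(1) mu] eq by auto
  then obtain t where t: "t \<noteq> 0" "ops_eval mu 2 = ops_eval lam t" by auto
  show thesis
  proof
    fix i assume i: "i < p + q"
    have "(2::complex) powi (mu ! i) = t powi (lam ! i)"
      using arg_cong[OF t(2), of "\<lambda>M. M $$ (i,i)"] i by (simp add: ops_eval_def len mat_diag_nth)
    then have "norm ((2::complex) powi (mu ! i)) = norm (t powi (lam ! i))" by simp
    then have "(2::real) powi (mu ! i) = norm t powi (lam ! i)" by (simp add: norm_power_int)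
    then have "(2::real) powr (mu ! i) = norm t powr (lam ! i)"
      using t(1) by (simp add: powr_real_of_int')
    then have "ln ((2::real) powr (mu ! i)) = ln (norm t powr (lam ! i))" by simp
    then have "mu ! i * ln 2 = lam ! i * ln (norm t)" using t(1) by (simp add: ln_powr)
    then show "real_of_int (mu ! i) = ln (norm t) / ln 2 * lam ! i" by (simp add: field_simps)
  qed
qed

text \<open>Subtracting the mean turns any integer function that is constant along the edges into a
  one-parameter subgroup.\<close>

lemma admissible_imp_affine:
  assumes v: "v \<in> p_minus p q" and lam: "lam \<in> one_param_subgroups p q"
    and eq: "ops_eval lam ` (- {0}) = identity_component (p + q) (T_stabilizer p q v)"
    and f: "\<And>r s. \<lbrakk>r < p + q; s < p + q; v $$ (r,s) \<noteq> 0\<rbrakk> \<Longrightarrow> f r = (f s :: int)"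
  obtains c e :: real where "\<And>i. i < p + q \<Longrightarrow> real_of_int (f i) = c * lam ! i + e"
proof -
  define n where "n = p + q"
  define S where "S = (\<Sum>i<n. f i)"
  \<comment> \<open>The mean \<open>S / n\<close> need not be an integer, so \<open>f\<close> is
    scaled by \<open>n\<close> before the subtraction; the factor is divided out at the end.\<close>
  define mu where "mu = map (\<lambda>i. int n * f i - S) [0..<n]"
  have mu_nth: "mu ! i = int n * f i - S" if "i < n" for i using that by (simp add: mu_def)
  have "sum_list mu = (\<Sum>i<n. int n * f i - S)"
    unfolding mu_def by (simp add: interv_sum_list_conv_sum_set_nat atLeast0LessThan)
  also have "\<dots> = 0" by (simp add: sum_subtractf S_def sum_distrib_left)
  finally have "mu \<in> one_param_subgroups p q"
    by (simp add: one_param_subgroups_def mu_def n_def)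
  moreover have "\<forall>r<p+q. \<forall>s<p+q. v $$ (r,s) \<noteq> 0 \<longrightarrow> mu ! r = mu ! s"
    using f by (simp add: mu_nth n_def[symmetric])
  ultimately obtain c :: real where c: "\<And>i. i < p + q \<Longrightarrow> real_of_int (mu ! i) = c * lam ! i"
    using admissible_imp_proportional[OF v lam eq] by metis
  show thesis
  proof
    fix i assume i: "i < p + q"
    then have "real n * f i - S = c * lam ! i" using c[OF i] by (simp add: mu_nth n_def)
    moreover have "real n \<noteq> 0" using i n_def by simp
    ultimately show "real_of_int (f i) = (c / n) * lam ! i + S / n" by (simp add: field_simps)
  qed
qed

lemma one_param_nonzero_imp_nonconstant:
  assumes "lam \<in> one_param_subgroups p q" "i < p + q" "lam ! i \<noteq> 0"
  shows "\<exists>j<p+q. lam ! j \<noteq> lam ! i"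
proof (rule ccontr)
  assume "\<not> ?thesis"
  then have c: "lam ! j = lam ! i" if "j < p + q" for j using that by blast
  have "0 = (\<Sum>j<p+q. lam ! j)"
    using assms by (auto simp: one_param_subgroups_def sum_list_sum_nth atLeast0LessThan)
  also have "\<dots> = (\<Sum>j<p+q. lam ! i)" using c by (intro sum.cong) auto
  also have "\<dots> = (int p + int q) * lam ! i" by simp
  finally show False using assms by auto
qed

text \<open>Since \<open>lam\<close> is constant along edges, so is the indicator of the level set
  of \<open>i\<close>, which is therefore an affine function of \<open>lam\<close>. Taking both
  values 1 and 0, it has nonzero slope, hence it cannot vanish at two different values of
  \<open>lam\<close>.\<close>

lemma admissible_imp_two_valued:
  assumes "p_minus_admissible p q lam" and lam: "lam \<in> one_param_subgroups p q"
    and i: "i < p + q" "lam ! i \<noteq> 0"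
    and j: "j < p + q" "lam ! j \<noteq> lam ! i" and k: "k < p + q" "lam ! k \<noteq> lam ! i"
  shows "lam ! j = lam ! k"
proof -
  obtain v where v: "v \<in> p_minus p q"
    and eq: "ops_eval lam ` (- {0}) = identity_component (p + q) (T_stabilizer p q v)"
    using assms(1) unfolding p_minus_admissible_def by blast
  define f :: "nat \<Rightarrow> int" where "f r = of_bool (lam ! r = lam ! i)" for r
  have "f r = f s" if "r < p + q" "s < p + q" "v $$ (r,s) \<noteq> 0" for r s
    using admissible_imp_edge[OF v lam eq that] by (simp add: f_def)
  then obtain c e :: real where ce: "\<And>i. i < p + q \<Longrightarrow> real_of_int (f i) = c * lam ! i + e"
    using admissible_imp_affine[OF v lam eq] by metis
  have fi: "f i = 1" "f j = 0" "f k = 0" using j k by (auto simp: f_def)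
  have "c \<noteq> 0" using ce[OF i(1)] ce[OF j(1)] fi by auto
  moreover have "c * lam ! j = c * lam ! k" using ce[OF j(1)] ce[OF k(1)] fi by linarith
  ultimately show ?thesis by simp
qed

text \<open>An index whose value does not occur on the other side of the bipartition is an isolated vertex
  of the graph of \<open>v\<close>, hence a whole component.\<close>

definition one_sided_values_unique :: "nat \<Rightarrow> nat \<Rightarrow> int list \<Rightarrow> bool" where
  "one_sided_values_unique p q lam \<longleftrightarrow>
     (\<forall>i<p+q. (\<forall>j<p+q. lam ! j = lam ! i \<longrightarrow> (j < p \<longleftrightarrow> i < p)) \<longrightarrow>
       (\<forall>j<p+q. lam ! j = lam ! i \<longrightarrow> j = i))"

text \<open>The indicator of an isolated vertex \<open>i\<close> is constant along edges. Being
  affine in \<open>lam\<close>, it cannot separate \<open>i\<close> from another index with the same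
  value.\<close>

lemma admissible_imp_one_sided_values_unique:
  assumes "p_minus_admissible p q lam" and lam: "lam \<in> one_param_subgroups p q"
  shows "one_sided_values_unique p q lam"
  unfolding one_sided_values_unique_def
proof (intro allI impI)
  fix i j
  assume i: "i < p + q" and side: "\<forall>j<p+q. lam ! j = lam ! i \<longrightarrow> (j < p \<longleftrightarrow> i < p)"
    and j: "j < p + q" "lam ! j = lam ! i"
  obtain v where v: "v \<in> p_minus p q"
    and eq: "ops_eval lam ` (- {0}) = identity_component (p + q) (T_stabilizer p q v)"
    using assms(1) unfolding p_minus_admissible_def by blast
  define f :: "nat \<Rightarrow> int" where "f r = of_bool (r = i)" for r
  have "f r = f s" if rs: "r < p + q" "s < p + q" "v $$ (r,s) \<noteq> 0" for r s
  proof -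
    \<comment> \<open>An edge at \<open>i\<close> would lead to an index of equal value on the other
      side, against \<open>side\<close>.\<close>
    have "r \<noteq> i" "s \<noteq> i"
      using admissible_imp_edge[OF v lam eq rs] p_minus_support[OF v rs] side rs
      by (metis not_less)+
    then show ?thesis by (simp add: f_def)
  qed
  then obtain c e :: real where ce: "\<And>i. i < p + q \<Longrightarrow> real_of_int (f i) = c * lam ! i + e"
    using admissible_imp_affine[OF v lam eq] by metis
  have "f j = f i" using ce[OF i] ce[OF j(1)] j(2) by simp
  then show "j = i" by (simp add: f_def split: if_splits)
qed

section \<open>Sufficiency of these conditions for coprime values\<close>

lemma coprime_powi_parametrization:
  fixes x y :: complex and a b :: int
  assumes "x \<noteq> 0" "y \<noteq> 0" "coprime a b" "x powi b * y powi a = 1"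
  obtains s where "s \<noteq> 0" "x = s powi a" "y = s powi (- b)"
proof -
  obtain u w where uw: "u * b + w * a = 1"
    using assms(3) by (metis bezout_int coprime_iff_gcd_eq_1 gcd.commute)
  \<comment> \<open>The choice is forced: if \<open>x = s powi a\<close> and
    \<open>y = s powi (- b)\<close>, then the right-hand side is \<open>s\<close> to the power
    \<open>w * a + u * b\<close>, which is 1.\<close>
  define s where "s = x powi w * y powi (- u)"
  \<comment> \<open>The additional factor is a power of 1; it cancels the powers of \<open>y\<close>
    here and, in the second computation, those of \<open>x\<close>.\<close>
  have "s powi a * (x powi b * y powi a) powi u = x powi (w * a) * x powi (u * b) * (y powi (- u * a) * y powi (u * a))"
    by (simp only: s_def power_int_mult_distrib power_int_mult[symmetric] mult.assoc mult.commute
        mult.left_commute)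
  also have "\<dots> = x powi (u * b + w * a)"
    using assms(1,2) by (simp flip: power_int_add add: add.commute)
  finally have 1: "s powi a = x" by (simp add: uw assms(4))
  have "s powi (- b) * (x powi b * y powi a) powi w = x powi (w * - b) * x powi (w * b) * (y powi (- u * - b) * y powi (w * a))"
    by (simp only: s_def power_int_mult_distrib power_int_mult[symmetric] mult.assoc mult.commute
        mult.left_commute)
  also have "\<dots> = y powi (u * b + w * a)"
    using assms(1,2) by (simp flip: power_int_add)
  finally have 2: "s powi (- b) = y" by (simp add: uw assms(4))
  have "s \<noteq> 0" using assms(1,2) by (simp add: s_def)
  then show thesis using that 1 2 by blast
qed

lemma two_valued_imp_admissible:
  assumes lam: "lam \<in> one_param_subgroups p q"
    and vals: "\<And>i. i < p + q \<Longrightarrow> lam ! i = a \<or> lam ! i = - b"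
    and ab: "a > 0" "b > 0" "coprime a b"
    and occ: "i0 < p + q" "lam ! i0 = a" "i1 < p + q" "lam ! i1 = - b"
    and unique: "one_sided_values_unique p q lam"
  shows "p_minus_admissible p q lam"
proof -
  define n where "n = p + q"
  have len: "length lam = n" and sum: "(\<Sum>i<n. lam ! i) = 0"
    using lam by (auto simp: one_param_subgroups_def sum_list_sum_nth atLeast0LessThan n_def)
  \<comment> \<open>The largest support along which \<open>lam\<close> is constant.\<close>
  define v :: "complex mat" where
    "v = Matrix.mat n n (\<lambda>(r,s). if p \<le> r \<and> s < p \<and> lam ! r = lam ! s then 1 else 0)"
  have v: "v \<in> p_minus p q"
    unfolding p_minus_def mem_Collect_eq
    by (rule exI[of _ "Matrix.mat q p (\<lambda>(j,i). if lam ! (p + j) = lam ! i then 1 else 0)"])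
      (auto simp: v_def n_def intro!: eq_matI)
  let ?H = "T_stabilizer p q v"
  have const: "d i = d j"
    if d: "\<forall>r<n. \<forall>s<n. v $$ (r,s) \<noteq> 0 \<longrightarrow> d r = d s" and ij: "i < n" "j < n" "lam ! i = lam ! j"
    for d :: "nat \<Rightarrow> complex" and i j
  proof -
    have across: "d r = d s" if "p \<le> r" "r < n" "s < p" "lam ! r = lam ! s" for r s
      using d that by (simp add: v_def n_def)
    show ?thesis
    proof (cases "i = j")
      case False
      \<comment> \<open>A level set with two elements meets both sides, so \<open>i\<close> has a
        neighbour \<open>k\<close> across; \<open>j\<close> is then adjacent to \<open>k\<close> or
        to \<open>i\<close>, depending on its side.\<close>
      then obtain k where "k < n" "lam ! k = lam ! i" "(k < p) \<noteq> (i < p)"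
        using unique ij unfolding one_sided_values_unique_def n_def by metis
      then show ?thesis using across ij n_def by (metis not_less)
    qed simp
  qed
  define M N where "M = card {i\<in>{..<n}. lam ! i = a}" and "N = card {i\<in>{..<n}. lam ! i \<noteq> a}"
  have sumab: "int M * a = int N * b"
  proof -
    have "(\<Sum>i<n. lam ! i) = (\<Sum>i<n. if lam ! i = a then a else - b)"
      using vals n_def by (intro sum.cong) auto
    also have "\<dots> = int M * a - int N * b"
      by (simp add: sum.If_cases M_def N_def Int_def conj_commute)
    finally show ?thesis using sum by simp
  qed
  \<comment> \<open>The vanishing sum gives \<open>M * a = N * b\<close>, so by coprimality the
    sizes of the level sets are \<open>b * g\<close> and \<open>a * g\<close> for a common
    \<open>g\<close>.\<close>
  have "b dvd int M" using sumab ab(3)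
    by (metis coprime_commute coprime_dvd_mult_left_iff dvd_triv_right)
  then obtain g0 where g0: "int M = b * g0" by blast
  have "i0 \<in> {i\<in>{..<n}. lam ! i = a}" using occ n_def by simp
  then have "M > 0" unfolding M_def by (auto simp: card_gt_0_iff)
  then have "g0 > 0" using g0 ab(2) by (metis of_nat_0_less_iff zero_less_mult_pos)
  define g where "g = nat g0"
  have g: "int M = b * int g" "int N = a * int g"
    using g0 \<open>g0 > 0\<close> sumab ab by (auto simp: g_def algebra_simps)
  have "g > 0" using \<open>g0 > 0\<close> by (simp add: g_def)
  \<comment> \<open>An element of \<open>?H\<close> has one entry \<open>x\<close> on the level set
    of \<open>a\<close> and one entry \<open>y\<close> on the other. Its determinant is the
    \<open>g\<close>-th power of \<open>chi\<close>, and the kernel of \<open>chi\<close> in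
    \<open>?H\<close> is the image of \<open>lam\<close>.\<close>
  define chi :: "complex mat \<Rightarrow> complex" where
    "chi A = (A $$ (i0,i0)) powi b * (A $$ (i1,i1)) powi a" for A
  have elt: "\<exists>d. A = mat_diag n d \<and> (\<forall>i<n. d i = (if lam ! i = a then d i0 else d i1)) \<and>
      d i0 \<noteq> 0 \<and> d i1 \<noteq> 0 \<and> chi A ^ g = 1" if A: "A \<in> ?H" for A
  proof -
    obtain d where d: "A = mat_diag n d" "(\<Prod>i<n. d i) = 1"
      "\<forall>r<n. \<forall>s<n. v $$ (r,s) \<noteq> 0 \<longrightarrow> d r = d s"
      using A unfolding T_stabilizer_eq[OF v] n_def by blast
    have di: "d i = (if lam ! i = a then d i0 else d i1)" if "i < n" for i
      using const[OF d(3)] vals occ that n_def by metis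
    have nz: "d i \<noteq> 0" if "i < n" for i
      using d(2) that by (metis finite_lessThan lessThan_iff prod_zero zero_neq_one)
    have "(\<Prod>i<n. d i) = (\<Prod>i<n. if lam ! i = a then d i0 else d i1)"
      using di by (intro prod.cong) auto
    also have "\<dots> = d i0 ^ M * d i1 ^ N"
      by (simp add: prod.If_cases M_def N_def Int_def conj_commute)
    also have "\<dots> = d i0 powi (b * int g) * d i1 powi (a * int g)"
      by (simp flip: g)
    also have "\<dots> = (d i0 powi b * d i1 powi a) ^ g"
      by (simp add: power_mult_distrib power_int_mult)
    also have "\<dots> = chi A ^ g" using occ by (simp add: chi_def d(1) mat_diag_nth n_def)
    finally have "chi A ^ g = 1" using d(2) by simp
    moreover have "d i0 \<noteq> 0" "d i1 \<noteq> 0" using nz occ n_def by auto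
    ultimately show ?thesis using d(1) di by blast
  qed
  have ops_sub: "ops_eval lam ` (- {0}) \<subseteq> identity_component n ?H"
    unfolding n_def by (rule ops_image_subset_identity_component[OF v lam])
      (simp add: v_def n_def)
  \<comment> \<open>On the connected identity component \<open>chi\<close> takes values among the
    finitely many \<open>g\<close>-th roots of unity, so it is constant, with its value at the
    identity matrix.\<close>
  have chi1: "chi A = 1" if A: "A \<in> identity_component n ?H" for A
  proof -
    have comp: "connectedin (subtopology (mat_topology n) ?H) (identity_component n ?H)"
      unfolding identity_component_def by (rule connectedin_connected_component_of)
    have cont: "continuous_map (subtopology (mat_topology n) ?H) euclidean chi"
    proof -
      let ?h = "\<lambda>z :: complex \<times> complex. fst z powi b * snd z powi a"
      \<comment> \<open>The exponents are positive, so \<open>?h\<close> is continuous also where a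
        coordinate vanishes.\<close>
      have "continuous_on UNIV ?h"
        using ab by (intro continuous_intros) auto
      then have "continuous_map (prod_topology euclidean euclidean) euclidean ?h" by simp
      moreover have "continuous_map (mat_topology n) (prod_topology euclidean euclidean)
          (\<lambda>A. (A $$ (i0,i0), A $$ (i1,i1)))"
        using occ n_def by (intro continuous_map_pairedI continuous_map_mat_entry) auto
      ultimately have "continuous_map (mat_topology n) euclidean
          (?h \<circ> (\<lambda>A. (A $$ (i0,i0), A $$ (i1,i1))))"
        by (rule continuous_map_compose[rotated])
      then show ?thesis by (simp add: o_def chi_def[abs_def] continuous_map_from_subtopology)
    qed
    have "connected (chi ` identity_component n ?H)"
      using connectedin_continuous_map_image[OF cont comp] by simp
    moreover have "chi ` identity_component n ?H \<subseteq> {z. z ^ g = 1}"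
      using elt identity_component_subset by blast
    then have "finite (chi ` identity_component n ?H)"
      using finite_nth_roots[OF \<open>g > 0\<close>, of 1] finite_subset by blast
    ultimately obtain w where w: "chi ` identity_component n ?H = {w}"
      using connected_finite_iff_sing[of "chi ` identity_component n ?H"] A by auto
    have "1\<^sub>m n \<in> identity_component n ?H"
      using ops_sub ops_eval_1[OF len] by (metis Compl_iff image_subset_iff singletonD zero_neq_one)
    moreover have "chi (1\<^sub>m n) = 1" using occ by (simp add: chi_def n_def)
    ultimately show ?thesis using w A by (metis image_eqI singletonD)
  qed
  have "identity_component n ?H \<subseteq> ops_eval lam ` (- {0})"
  proof
    fix A assume A: "A \<in> identity_component n ?H"
    then obtain d where d: "A = mat_diag n d" "\<forall>i<n. d i = (if lam ! i = a then d i0 else d i1)"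
      "d i0 \<noteq> 0" "d i1 \<noteq> 0"
      using elt identity_component_subset by blast
    have "d i0 powi b * d i1 powi a = 1"
      using chi1[OF A] occ by (simp add: chi_def d(1) mat_diag_nth n_def)
    then obtain s where s: "s \<noteq> 0" "d i0 = s powi a" "d i1 = s powi (- b)"
      using coprime_powi_parametrization[OF d(3,4) ab(3)] by metis
    have "A = ops_eval lam s"
      unfolding d(1) ops_eval_def len using d(2) s vals n_def by (intro mat_diag_cong) metis
    then show "A \<in> ops_eval lam ` (- {0})" using s by simp
  qed
  with ops_sub show ?thesis unfolding p_minus_admissible_def n_def using v by blast
qed

section \<open>Dominant two-valued tuples and their block sizes\<close>

lemma sorted_two_valued_eq_replicate:
  fixes a b :: "'a::linorder"
  assumes "sorted_wrt (\<ge>) xs" "\<forall>x\<in>set xs. x = a \<or> x = b" "b < a"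
  shows "\<exists>k\<le>length xs. xs = replicate k a @ replicate (length xs - k) b"
  using assms
proof (induction xs)
  case (Cons x xs)
  show ?case
  proof (cases "x = a")
    case True
    from Cons obtain k where "k \<le> length xs" "xs = replicate k a @ replicate (length xs - k) b"
      by auto
    with True show ?thesis by (intro exI[of _ "Suc k"]) auto
  next
    case False
    \<comment> \<open>The head is the smaller value \<open>b\<close>, and everything after it is at
      most \<open>b\<close>.\<close>
    then have "\<forall>y\<in>set (x # xs). y = b" using Cons.prems by fastforce
    then have "x # xs = replicate (length (x # xs)) b" by (intro replicate_eqI) auto
    then show ?thesis by (intro exI[of _ 0]) auto
  qed
qed simp

text \<open>The shape of \<open>lam_kl\<close> with free values, so that a tuple can be put into
  this form before its values are known.\<close>

definition two_blocks :: "nat \<Rightarrow> nat \<Rightarrow> nat \<Rightarrow> nat \<Rightarrow> int \<Rightarrow> int \<Rightarrow> int list" where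
  "two_blocks p q k l a b = replicate k a @ replicate (p - k) b @ replicate l a @ replicate (q - l) b"

lemma length_two_blocks: "\<lbrakk>k \<le> p; l \<le> q\<rbrakk> \<Longrightarrow> length (two_blocks p q k l a b) = p + q"
  by (simp add: two_blocks_def)

lemma two_blocks_nth:
  "\<lbrakk>k \<le> p; l \<le> q; i < p + q\<rbrakk> \<Longrightarrow>
    two_blocks p q k l a b ! i = (if i < k \<or> p \<le> i \<and> i < p + l then a else b)"
  by (auto simp: two_blocks_def nth_append)

lemma sum_list_two_blocks:
  "\<lbrakk>k \<le> p; l \<le> q\<rbrakk> \<Longrightarrow>
    sum_list (two_blocks p q k l a b) = (int k + int l) * a + (int p + int q - int k - int l) * b"
  by (simp add: two_blocks_def sum_list_replicate of_nat_diff algebra_simps)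

lemma map_times_two_blocks:
  "map (\<lambda>x. c * x) (two_blocks p q k l a b) = two_blocks p q k l (c * a) (c * b)"
  by (simp add: two_blocks_def)

lemma dominant_two_blocks:
  assumes "k \<le> p" "b \<le> a"
  shows "dominant p (two_blocks p q k l a b)"
proof -
  have "sorted_wrt (\<ge>) (replicate m c)" for m and c :: int by (induction m) auto
  then show ?thesis using assms by (auto simp: dominant_def two_blocks_def sorted_wrt_append)
qed

lemma dominant_two_valued_eq_two_blocks:
  assumes "dominant p lam" "length lam = p + q" "\<forall>i<p+q. lam ! i = a \<or> lam ! i = b" "b < a"
  obtains k l where "k \<le> p" "l \<le> q" "lam = two_blocks p q k l a b"
proof -
  have vals: "\<forall>x\<in>set lam. x = a \<or> x = b" using assms(2,3) by (auto simp: in_set_conv_nth)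
  have "\<exists>k\<le>p. take p lam = replicate k a @ replicate (p - k) b"
    using sorted_two_valued_eq_replicate[of "take p lam" a b] assms vals
    by (auto simp: dominant_def dest: in_set_takeD)
  moreover have "\<exists>l\<le>q. drop p lam = replicate l a @ replicate (q - l) b"
    using sorted_two_valued_eq_replicate[of "drop p lam" a b] assms vals
    by (auto simp: dominant_def dest: in_set_dropD)
  ultimately show thesis using that unfolding two_blocks_def by (metis append_assoc append_take_drop_id)
qed

text \<open>Numerical form of \<open>one_sided_values_unique\<close>: the two level sets have parts
  of sizes \<open>k\<close>, \<open>l\<close> and \<open>p - k\<close>, \<open>q - l\<close> on the
  two sides, and an empty part leaves at most one element for its partner.\<close>

definition unique_block_sizes :: "nat \<Rightarrow> nat \<Rightarrow> nat \<Rightarrow> nat \<Rightarrow> bool" where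
  "unique_block_sizes p q k l \<longleftrightarrow>
     (k = 0 \<longrightarrow> l \<le> 1) \<and> (l = 0 \<longrightarrow> k \<le> 1) \<and> (k = p \<longrightarrow> q - l \<le> 1) \<and> (l = q \<longrightarrow> p - k \<le> 1)"

lemma one_sided_values_unique_two_blocks_iff:
  assumes kl: "k \<le> p" "l \<le> q" and "a \<noteq> b"
  shows "one_sided_values_unique p q (two_blocks p q k l a b) \<longleftrightarrow> unique_block_sizes p q k l"
proof -
  let ?L = "two_blocks p q k l a b"
  define A where "A i \<longleftrightarrow> i < k \<or> p \<le> i \<and> i < p + l" for i
  have eq_iff: "?L ! j = ?L ! i \<longleftrightarrow> (A j \<longleftrightarrow> A i)" if "i < p + q" "j < p + q" for i j
    using \<open>a \<noteq> b\<close> by (cases "A i"; cases "A j") (auto simp: two_blocks_nth[OF kl] that A_def)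
  have *: "one_sided_values_unique p q ?L \<longleftrightarrow>
     (\<forall>i<p+q. (\<forall>j<p+q. (A j \<longleftrightarrow> A i) \<longrightarrow> (j < p \<longleftrightarrow> i < p)) \<longrightarrow>
       (\<forall>j<p+q. (A j \<longleftrightarrow> A i) \<longrightarrow> j = i))" (is "_ \<longleftrightarrow> ?U")
    unfolding one_sided_values_unique_def by (simp add: eq_iff)
  have "?U \<longleftrightarrow> unique_block_sizes p q k l"
  proof
    assume u: ?U
    have D: "j = i" if "i < p + q" "j < p + q" "A j \<longleftrightarrow> A i"
      "\<And>r. \<lbrakk>r < p + q; A r \<longleftrightarrow> A i\<rbrakk> \<Longrightarrow> (r < p \<longleftrightarrow> i < p)" for i j
      using u that by blast
    have "l \<le> 1" if "k = 0"
    proof (rule ccontr)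
      assume "\<not> l \<le> 1"
      \<comment> \<open>\<open>D\<close> is applied to the first two indices of the block that is
        too long; the three cases below do the same.\<close>
      then have "p + 1 = p" using kl that by (intro D) (auto simp: A_def)
      then show False by simp
    qed
    moreover have "k \<le> 1" if "l = 0"
    proof (rule ccontr)
      assume "\<not> k \<le> 1"
      then have "1 = (0::nat)" using kl that by (intro D) (auto simp: A_def)
      then show False by simp
    qed
    moreover have "q - l \<le> 1" if "k = p"
    proof (rule ccontr)
      assume "\<not> q - l \<le> 1"
      then have "p + l + 1 = p + l" using kl that by (intro D) (auto simp: A_def)
      then show False by simp
    qed
    moreover have "p - k \<le> 1" if "l = q"
    proof (rule ccontr)
      assume "\<not> p - k \<le> 1"
      then have "k + 1 = k" using kl that by (intro D) (auto simp: A_def)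
      then show False by simp
    qed
    ultimately show "unique_block_sizes p q k l" by (simp add: unique_block_sizes_def)
  next
    assume c: "unique_block_sizes p q k l"
    show ?U
    proof (intro allI impI)
      fix i j
      assume i: "i < p + q" and side: "\<forall>r<p+q. (A r \<longleftrightarrow> A i) \<longrightarrow> (r < p \<longleftrightarrow> i < p)"
        and j: "j < p + q" "A j \<longleftrightarrow> A i"
      have ji: "j < p \<longleftrightarrow> i < p" using side j by blast
      have S: "r < p \<longleftrightarrow> i < p" if "r < p + q" "A r \<longleftrightarrow> A i" for r using side that by blast
      \<comment> \<open>One case per block. In each, \<open>S\<close> at the first index of the
        block of equal value across the bipartition shows that block to be empty.\<close>
      consider "i < k" | "k \<le> i" "i < p" | "p \<le> i" "i < p + l" | "p + l \<le> i"
        by linarith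
      then show "j = i"
      proof cases
        case 1
        then have "l = 0" using S[of p] i kl by (cases "l = 0") (auto simp: A_def)
        then have "k \<le> 1" "j < k" using 1 c j ji kl by (auto simp: unique_block_sizes_def A_def)
        with 1 show ?thesis by linarith
      next
        case 2
        then have "l = q" using S[of "p + l"] i kl by (cases "l = q") (auto simp: A_def)
        then have "p - k \<le> 1" "k \<le> j" "j < p"
          using 2 c j ji kl by (auto simp: unique_block_sizes_def A_def)
        with 2 show ?thesis by linarith
      next
        case 3
        then have "k = 0" using S[of 0] i kl by (cases "k = 0") (auto simp: A_def)
        then have "l \<le> 1" "p \<le> j" "j < p + l"
          using 3 c j ji kl by (auto simp: unique_block_sizes_def A_def)
        with 3 show ?thesis by linarith
      next
        case 4
        then have "k = p" using S[of k] i kl by (cases "k = p") (auto simp: A_def)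
        then have "q - l \<le> 1" "p + l \<le> j"
          using 4 c j ji kl by (auto simp: unique_block_sizes_def A_def)
        with 4 i j(1) show ?thesis by linarith
      qed
    qed
  qed
  with * show ?thesis by simp
qed

section \<open>Properties of the tuples \<open>lam_kl\<close>\<close>

lemma lam_kl_eq_two_blocks:
  assumes "0 < k + l" "k + l < p + q"
  obtains a b where "lam_kl p q k l = two_blocks p q k l a (- b)" "a > 0" "b > 0" "coprime a b"
    "(int k + int l) * a = (int p + int q - int k - int l) * b"
proof -
  define m n where "m = int p + int q - int k - int l" and "n = int k + int l"
  have mn: "m > 0" "n > 0" using assms by (auto simp: m_def n_def)
  define g where "g = gcd m n"
  have g: "g > 0" "g dvd m" "g dvd n" using mn by (auto simp: g_def)
  \<comment> \<open>The sign passes through \<open>div\<close> because \<open>g\<close> divides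
    \<open>n\<close> exactly.\<close>
  have "lam_kl p q k l = two_blocks p q k l (m div g) (- (n div g))"
    using g(3) by (simp add: lam_kl_def two_blocks_def Let_def m_def[symmetric] n_def[symmetric]
        g_def[symmetric] dvd_neg_div)
  moreover have "m div g > 0" "n div g > 0"
    using mn g by (auto simp: pos_imp_zdiv_pos_iff zdvd_imp_le)
  moreover have "coprime (m div g) (n div g)"
    using mn unfolding g_def by (intro div_gcd_coprime) auto
  moreover have "n * (m div g) = m * (n div g)"
    using g by (metis div_mult_swap mult.commute)
  ultimately show thesis using that unfolding m_def n_def by blast
qed

lemma lam_kl_one_param:
  assumes "k \<le> p" "l \<le> q" "0 < k + l" "k + l < p + q"
  shows "lam_kl p q k l \<in> one_param_subgroups p q"
proof -
  obtain a b where "lam_kl p q k l = two_blocks p q k l a (- b)"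
    "(int k + int l) * a = (int p + int q - int k - int l) * b"
    using lam_kl_eq_two_blocks[OF assms(3,4)] by metis
  then show ?thesis using assms
    by (simp add: one_param_subgroups_def length_two_blocks sum_list_two_blocks)
qed

lemma two_blocks_indices:
  assumes "k \<le> p" "l \<le> q" "0 < k + l" "k + l < p + q"
  obtains i j where "i < p + q" "two_blocks p q k l a b ! i = a"
    "j < p + q" "two_blocks p q k l a b ! j = b"
proof -
  let ?i = "if k = 0 then p else 0" and ?j = "if k = p then p + l else k"
  have "?i < p + q" "two_blocks p q k l a b ! ?i = a" "?j < p + q" "two_blocks p q k l a b ! ?j = b"
    using assms by (auto simp: two_blocks_nth)
  then show thesis using that by blast
qed

text \<open>Both values occur, so a common factor \<open>n\<close> of the tuple divides the coprime
  numbers \<open>a\<close> and \<open>b\<close>.\<close>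

lemma indivisible_two_blocks:
  assumes kl: "k \<le> p" "l \<le> q" "0 < k + l" "k + l < p + q" and "coprime a b"
  shows "indivisible p q (two_blocks p q k l a (- b))"
  unfolding indivisible_def
proof
  let ?L = "two_blocks p q k l a (- b)"
  assume "\<exists>n>1. \<exists>mu\<in>one_param_subgroups p q. ?L = map (\<lambda>x. n * x) mu"
  then obtain n mu where n: "n > 1" "?L = map (\<lambda>x. n * x) mu" "length mu = p + q"
    unfolding one_param_subgroups_def by blast
  obtain i j where ij: "i < p + q" "?L ! i = a" "j < p + q" "?L ! j = - b"
    using two_blocks_indices[OF kl] by metis
  have "n dvd a" using n ij(1,2) by (metis dvd_triv_left nth_map)
  moreover have "n dvd b" using n ij(3,4) by (metis dvd_triv_left nth_map dvd_minus_iff)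
  ultimately have "is_unit n" using \<open>coprime a b\<close> by (metis coprime_common_divisor)
  then show False using n(1) by simp
qed

lemma lam_kl_dominant_indivisible_admissible:
  assumes kl: "k \<le> p" "l \<le> q" "0 < k + l" "k + l < p + q" and "unique_block_sizes p q k l"
  shows "dominant p (lam_kl p q k l)" "indivisible p q (lam_kl p q k l)"
    "p_minus_admissible p q (lam_kl p q k l)"
proof -
  obtain a b where ab: "lam_kl p q k l = two_blocks p q k l a (- b)" "a > 0" "b > 0" "coprime a b"
    using lam_kl_eq_two_blocks[OF kl(3,4)] by metis
  show "dominant p (lam_kl p q k l)"
    unfolding ab(1) using ab(2,3) kl by (intro dominant_two_blocks) auto
  show "indivisible p q (lam_kl p q k l)"
    unfolding ab(1) by (intro indivisible_two_blocks kl ab(4))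
  obtain i j where ij: "i < p + q" "lam_kl p q k l ! i = a" "j < p + q" "lam_kl p q k l ! j = - b"
    unfolding ab(1) using two_blocks_indices[OF kl] by metis
  have "one_sided_values_unique p q (lam_kl p q k l)"
    unfolding ab(1) using one_sided_values_unique_two_blocks_iff[OF kl(1,2), of a "- b"] assms(5) ab
    by auto
  with lam_kl_one_param[OF kl] show "p_minus_admissible p q (lam_kl p q k l)"
    using ab(2-4) ij
    by (intro two_valued_imp_admissible[of "lam_kl p q k l" p q a b i j])
      (auto simp: ab(1) two_blocks_nth kl)
qed

section \<open>Classification by block sizes\<close>

lemma dominant_indivisible_admissible_imp_lam_kl:
  assumes lam: "lam \<in> one_param_subgroups p q" and dom: "dominant p lam"
    and ind: "indivisible p q lam" and adm: "p_minus_admissible p q lam"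
  obtains k l where "k \<le> p" "l \<le> q" "0 < k + l" "k + l < p + q" "unique_block_sizes p q k l"
    "lam = lam_kl p q k l"
proof -
  have len: "length lam = p + q" and sum: "sum_list lam = 0"
    using lam by (auto simp: one_param_subgroups_def)
  have "\<exists>i<p+q. lam ! i \<noteq> 0"
  proof (rule ccontr)
    assume "\<not> ?thesis"
    \<comment> \<open>The zero tuple is twice itself, hence not indivisible.\<close>
    then have "lam = map (\<lambda>x. 2 * x) lam" using len by (intro nth_equalityI) auto
    with ind lam show False unfolding indivisible_def by (metis one_less_numeral_iff semiring_norm(76))
  qed
  then obtain i where i: "i < p + q" "lam ! i \<noteq> 0" by blast
  obtain j where j: "j < p + q" "lam ! j \<noteq> lam ! i"
    using one_param_nonzero_imp_nonconstant[OF lam i] by blast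
  \<comment> \<open>Here \<open>b\<close> is the smaller value with its sign, whereas the normalized
    values below are \<open>a'\<close> and \<open>- b'\<close>.\<close>
  define a b where "a = max (lam ! i) (lam ! j)" and "b = min (lam ! i) (lam ! j)"
  have "b < a" using j(2) by (auto simp: a_def b_def)
  have "\<forall>r<p+q. lam ! r = lam ! i \<or> lam ! r = lam ! j"
    using admissible_imp_two_valued[OF adm lam i j] by metis
  then have vals: "\<forall>r<p+q. lam ! r = a \<or> lam ! r = b" by (auto simp: a_def b_def max_def min_def)
  obtain k l where kl: "k \<le> p" "l \<le> q" and blocks: "lam = two_blocks p q k l a b"
    using dominant_two_valued_eq_two_blocks[OF dom len vals \<open>b < a\<close>] by metis
  have "lam ! i \<noteq> lam ! j" using j by simp
  then have pos: "0 < k + l" "k + l < p + q"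
    unfolding blocks two_blocks_nth[OF kl i(1)] two_blocks_nth[OF kl j(1)]
    using kl i(1) j(1) by (auto split: if_splits)
  have "unique_block_sizes p q k l"
    using one_sided_values_unique_two_blocks_iff[OF kl, of a b] \<open>b < a\<close>
      admissible_imp_one_sided_values_unique[OF adm lam] blocks by auto
  define m n where "m = int p + int q - int k - int l" and "n = int k + int l"
  have mn: "m > 0" "n > 0" using pos by (auto simp: m_def n_def)
  have nm: "n * a = m * (- b)"
    using sum unfolding blocks sum_list_two_blocks[OF kl] m_def n_def by simp
  have "a > 0"
  proof (rule ccontr)
    assume "\<not> a > 0"
    then have "n * a \<le> 0" "m * (- b) > 0" using mn \<open>b < a\<close>
      by (auto simp: mult_nonneg_nonpos mult_pos_neg)
    with nm show False by simp
  qed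
  obtain a' b' where ab': "lam_kl p q k l = two_blocks p q k l a' (- b')" "a' > 0" "b' > 0"
      "coprime a' b'" "n * a' = m * b'"
    using lam_kl_eq_two_blocks[OF pos] unfolding m_def n_def by metis
  \<comment> \<open>The vanishing sums make \<open>(a, b)\<close> proportional to
    \<open>(a', - b')\<close>. Coprimality turns the ratio into an integer \<open>c\<close>,
    positive because \<open>a\<close> and \<open>a'\<close> are, and indivisibility leaves
    \<open>c = 1\<close>.\<close>
  have "m * (a * b') = m * (- b * a')" using nm ab'(5) by (metis mult.assoc mult.commute)
  then have cross: "a * b' = - b * a'" using mn(1) by (metis mult_left_cancel less_irrefl)
  then have "a' dvd a" using ab'(4) by (metis coprime_dvd_mult_left_iff dvd_triv_right)
  then obtain c where c: "a = a' * c" by blast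
  have "c > 0" using c \<open>a > 0\<close> ab'(2) by (metis zero_less_mult_pos)
  have "a' * b = a' * (c * - b')" using cross by (simp add: c algebra_simps)
  then have bc: "b = c * - b'" using ab'(2) by (metis mult_left_cancel less_irrefl)
  have "lam = map (\<lambda>x. c * x) (lam_kl p q k l)"
    unfolding ab'(1) map_times_two_blocks blocks bc c by (simp add: mult.commute)
  then have "\<not> c > 1" using ind lam_kl_one_param[OF kl pos] unfolding indivisible_def by blast
  with \<open>c > 0\<close> have "c = 1" by simp
  then have "lam = lam_kl p q k l" unfolding ab'(1) blocks bc c by simp
  then show thesis using that kl pos \<open>unique_block_sizes p q k l\<close> by blast
qed

section \<open>The numerical list and the four extreme tuples\<close>

lemma unique_block_sizes_iff:
  assumes "p \<ge> 2" "q \<ge> 2"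
  shows "k \<le> p \<and> l \<le> q \<and> 0 < k + l \<and> k + l < p + q \<and> unique_block_sizes p q k l \<longleftrightarrow>
    k \<in> {1..p - 1} \<and> l \<in> {1..q - 1} \<or>
    (k, l) \<in> {(p, q - 1), (p - 1, q), (0, 1), (1, 0)}" (is "?L \<longleftrightarrow> ?R")
proof
  assume L: ?L
  \<comment> \<open>On the boundary of the rectangle one clause bounds a block by 1, and
    nonconstancy excludes 0; in the interior all clauses are vacuous.\<close>
  consider "k = 0" | "k = p" | "l = 0" | "l = q" | "0 < k" "k < p" "0 < l" "l < q"
    using L by linarith
  then show ?R
  proof cases
    case 1
    with L have "l = 1" by (simp add: unique_block_sizes_def)
    with 1 show ?thesis by simp
  next
    case 2
    with L have "q - l \<le> 1" "l < q" by (simp_all add: unique_block_sizes_def)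
    then have "l = q - 1" by linarith
    with 2 show ?thesis by simp
  next
    case 3
    with L have "k = 1" by (simp add: unique_block_sizes_def)
    with 3 show ?thesis by simp
  next
    case 4
    with L have "p - k \<le> 1" "k < p" by (simp_all add: unique_block_sizes_def)
    then have "k = p - 1" by linarith
    with 4 show ?thesis by simp
  next
    case 5
    then have "k \<in> {1..p - 1}" "l \<in> {1..q - 1}" by auto
    then show ?thesis by blast
  qed
next
  assume ?R
  then show ?L
  proof
    assume "k \<in> {1..p - 1} \<and> l \<in> {1..q - 1}"
    then have "0 < k" "k < p" "0 < l" "l < q" using assms by auto
    then show ?L by (simp add: unique_block_sizes_def)
  next
    assume "(k, l) \<in> {(p, q - 1), (p - 1, q), (0, 1), (1, 0)}"
    then consider "k = p" "l = q - 1" | "k = p - 1" "l = q" | "k = 0" "l = 1" | "k = 1" "l = 0"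
      by auto
    then show ?L
      by cases (use assms in \<open>simp_all add: unique_block_sizes_def\<close>)
  qed
qed

text \<open>In each case \<open>k + l\<close> or \<open>p + q - k - l\<close> is 1, so the gcd is
  1.\<close>

lemma lam_kl_extreme:
  assumes "p \<ge> 1" "q \<ge> 1"
  shows "lam_kl p q p (q - 1) = replicate p 1 @ replicate (q - 1) 1 @ [1 - int p - int q]"
    and "lam_kl p q (p - 1) q = replicate (p - 1) 1 @ [1 - int p - int q] @ replicate q 1"
    and "lam_kl p q 0 1 = replicate p (- 1) @ [int p + int q - 1] @ replicate (q - 1) (- 1)"
    and "lam_kl p q 1 0 = [int p + int q - 1] @ replicate (p - 1) (- 1) @ replicate q (- 1)"
  using assms by (auto simp: lam_kl_def Let_def)

theorem mainTheorem16:
  fixes p q :: nat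
  assumes "p \<ge> q" and "q \<ge> 2"
  shows "{lam \<in> one_param_subgroups p q.
            dominant p lam \<and> indivisible p q lam \<and> p_minus_admissible p q lam} =
         {lam_kl p q k l | k l. k \<in> {1..p - 1} \<and> l \<in> {1..q - 1}} \<union>
         {replicate p 1 @ replicate (q - 1) 1 @ [1 - int p - int q],
          replicate (p - 1) 1 @ [1 - int p - int q] @ replicate q 1,
          replicate p (- 1) @ [int p + int q - 1] @ replicate (q - 1) (- 1),
          [int p + int q - 1] @ replicate (p - 1) (- 1) @ replicate q (- 1)}"
proof -
  have pq: "p \<ge> 2" "q \<ge> 2" "p \<ge> 1" "q \<ge> 1" using assms by auto
  have "{lam \<in> one_param_subgroups p q.
            dominant p lam \<and> indivisible p q lam \<and> p_minus_admissible p q lam} =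
        {lam_kl p q k l | k l. k \<le> p \<and> l \<le> q \<and> 0 < k + l \<and> k + l < p + q \<and> unique_block_sizes p q k l}"
    (is "?L = ?R")
  proof
    show "?L \<subseteq> ?R"
    proof
      fix lam assume "lam \<in> ?L"
      then obtain k l where "k \<le> p" "l \<le> q" "0 < k + l" "k + l < p + q"
        "unique_block_sizes p q k l" "lam = lam_kl p q k l"
        using dominant_indivisible_admissible_imp_lam_kl[of lam p q] by blast
      then show "lam \<in> ?R" by blast
    qed
    show "?R \<subseteq> ?L"
      using lam_kl_one_param[of _ p _ q] lam_kl_dominant_indivisible_admissible[of _ p _ q] by blast
  qed
  also have "\<dots> = {lam_kl p q k l | k l. k \<in> {1..p - 1} \<and> l \<in> {1..q - 1}} \<union>
      {lam_kl p q p (q - 1), lam_kl p q (p - 1) q, lam_kl p q 0 1, lam_kl p q 1 0}"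
    unfolding unique_block_sizes_iff[OF pq(1,2)] by auto
  finally show ?thesis unfolding lam_kl_extreme[OF pq(3,4)] .
qed

end
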